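(* There do not exist regular clique assembly graphs $G_1$ and $G_2$ such that the Cartesian product $G_1\square G_2$ is a strongly regular graph with parameters $(99,14,1,2)$ (Conway's 99-graph). That is, if Conway's 99-graph exists, it cannot be constructed as the Cartesian product of two regular clique assembly graphs.
   Context: A strongly regular graph with parameters $(n,d,\lambda,\mu)$ is a graph on $n$ vertices, regular of degree $d$, in which every pair of adjacent vertices has exactly $\lambda$ common neighbors and every pair of distinct non-adjacent vertices has exactly $\mu$ common neighbors. A regular clique assembly $RCA(n,d,k)$ is a graph on $n$ vertices, regular of degree $d$, with clique number $k=\omega(G)\geq 2$, such that every maximal clique is a maximum clique and every edge lies in exactly one maximum clique. The Cartesian product $G_1\square G_2$ has vertex set $V(G_1)\times V(G_2)$, with $(u,u')\sim(v,v')$ iff either $u=v$ and $u'\sim v'$ in $G_2$, or $u\sim v$ in $G_1$ and $u'=v'$. *)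

theory Defs
  imports "Graph_Theory.Pair_Digraph"
begin

text \<open>
  A finite simple undirected graph is a \<^locale>\<open>pair_graph\<close>: finite vertex set, irreflexive and
  symmetric set of arcs. An edge \<open>uv\<close> is represented by the two arcs \<open>(u, v)\<close> and \<open>(v, u)\<close>, so the
  degree of a vertex is its \<^const>\<open>out_degree\<close>.
\<close>

definition regular_of_degree :: "'a pair_pre_digraph \<Rightarrow> nat \<Rightarrow> bool" where
  "regular_of_degree G d \<longleftrightarrow> (\<forall>v \<in> pverts G. out_degree (with_proj G) v = d)"

definition common_neighbors :: "'a pair_pre_digraph \<Rightarrow> 'a \<Rightarrow> 'a \<Rightarrow> 'a set" where
  "common_neighbors G u v = {w \<in> pverts G. (u, w) \<in> parcs G \<and> (v, w) \<in> parcs G}"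

definition strongly_regular :: "'a pair_pre_digraph \<Rightarrow> nat \<Rightarrow> nat \<Rightarrow> nat \<Rightarrow> nat \<Rightarrow> bool" where
  "strongly_regular G n d l m \<longleftrightarrow>
     pair_graph G \<and> card (pverts G) = n \<and> regular_of_degree G d \<and>
     (\<forall>u \<in> pverts G. \<forall>v \<in> pverts G.
        (u, v) \<in> parcs G \<longrightarrow> card (common_neighbors G u v) = l) \<and>
     (\<forall>u \<in> pverts G. \<forall>v \<in> pverts G.
        u \<noteq> v \<and> (u, v) \<notin> parcs G \<longrightarrow> card (common_neighbors G u v) = m)"

definition is_clique :: "'a pair_pre_digraph \<Rightarrow> 'a set \<Rightarrow> bool" where
  "is_clique G C \<longleftrightarrow>
     C \<subseteq> pverts G \<and> (\<forall>u \<in> C. \<forall>v \<in> C. u \<noteq> v \<longrightarrow> (u, v) \<in> parcs G)"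

definition clique_number :: "'a pair_pre_digraph \<Rightarrow> nat" where
  "clique_number G = Max (card ` {C. is_clique G C})"

definition maximal_clique :: "'a pair_pre_digraph \<Rightarrow> 'a set \<Rightarrow> bool" where
  "maximal_clique G C \<longleftrightarrow> is_clique G C \<and> (\<forall>D. is_clique G D \<and> C \<subseteq> D \<longrightarrow> D = C)"

definition maximum_clique :: "'a pair_pre_digraph \<Rightarrow> 'a set \<Rightarrow> bool" where
  "maximum_clique G C \<longleftrightarrow> is_clique G C \<and> card C = clique_number G"

definition regular_clique_assembly :: "'a pair_pre_digraph \<Rightarrow> nat \<Rightarrow> nat \<Rightarrow> nat \<Rightarrow> bool" where
  "regular_clique_assembly G n d k \<longleftrightarrow>
     pair_graph G \<and> card (pverts G) = n \<and> regular_of_degree G d \<and>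
     clique_number G = k \<and> k \<ge> 2 \<and>
     (\<forall>C. maximal_clique G C \<longrightarrow> maximum_clique G C) \<and>
     (\<forall>u v. (u, v) \<in> parcs G \<longrightarrow> (\<exists>!C. maximum_clique G C \<and> u \<in> C \<and> v \<in> C))"

definition cartesian_product ::
  "'a pair_pre_digraph \<Rightarrow> 'b pair_pre_digraph \<Rightarrow> ('a \<times> 'b) pair_pre_digraph"
  (infixr \<open>\<box>\<close> 80) where
  "G \<box> H =
     \<lparr> pverts = pverts G \<times> pverts H,
       parcs = {((u, u'), (v, v')) | u u' v v'.
         u \<in> pverts G \<and> v \<in> pverts G \<and> u' \<in> pverts H \<and> v' \<in> pverts H \<and>
         ((u = v \<and> (u', v') \<in> parcs H) \<or> ((u, v) \<in> parcs G \<and> u' = v'))} \<rparr>"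

lemma finite_cliques:
  assumes "pair_graph G"
  shows "finite {C. is_clique G C}"
proof -
  interpret pair_graph G by fact
  show ?thesis
    by (rule finite_subset[of _ "Pow (pverts G)"]) (auto simp: is_clique_def pair_finite_verts)
qed

lemma pair_graph_cartesian_product:
  assumes "pair_graph G" "pair_graph H"
  shows "pair_graph (G \<box> H)"
proof -
  interpret G: pair_graph G by fact
  interpret H: pair_graph H by fact
  have "parcs (G \<box> H) \<subseteq> (pverts G \<times> pverts H) \<times> (pverts G \<times> pverts H)"
    by (auto simp: cartesian_product_def)
  then have fin: "finite (parcs (G \<box> H))"
    by (rule finite_subset) (simp add: G.pair_finite_verts H.pair_finite_verts)
  have "sym (parcs (G \<box> H))"
    using G.pair_sym_arcs H.pair_sym_arcs
    by (auto simp: cartesian_product_def symmetric_def sym_def)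
  then show ?thesis
    using fin G.pair_finite_verts H.pair_finite_verts
    by unfold_locales
      (auto simp: cartesian_product_def symmetric_def dest: G.pair_no_loops H.pair_no_loops)
qed

end

theory Submission
  imports Defs
begin

text \<open>
  Two vertices of \<open>G \<box> H\<close> that differ in both coordinates are not adjacent, and their only possible
  common neighbours are the two mixed pairs. Since these vertices must have common neighbours, both
  factors are complete; every edge of a factor on \<open>n\<close> vertices then has \<open>n - 2\<close> common neighbours
  in the product, so \<open>\<lambda> = 1\<close> forces both factors to be triangles and the product has only 9 vertices.
\<close>

lemma parcs_cartesian_product_iff:
  "((u, x), (v, y)) \<in> parcs (G \<box> H) \<longleftrightarrow>
     u \<in> pverts G \<and> v \<in> pverts G \<and> x \<in> pverts H \<and> y \<in> pverts H \<and>
     (u = v \<and> (x, y) \<in> parcs H \<or> (u, v) \<in> parcs G \<and> x = y)"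
  by (auto simp: cartesian_product_def)

lemma pverts_cartesian_product: "pverts (G \<box> H) = pverts G \<times> pverts H"
  by (simp add: cartesian_product_def)

text \<open>Supplies the pairs of distinct vertices in both factors on which the later counting
  rests.\<close>

lemma two_vertices_if_clique_number:
  assumes "pair_graph G" "clique_number G \<ge> 2"
  shows "\<exists>u \<in> pverts G. \<exists>v \<in> pverts G. u \<noteq> v"
proof -
  \<comment> \<open>The empty clique makes the finite set under \<open>Max\<close> nonempty, so the
    maximum is attained by some clique.\<close>
  have "{} \<in> {C. is_clique G C}"
    by (simp add: is_clique_def)
  then have "Max (card ` {C. is_clique G C}) \<in> card ` {C. is_clique G C}"
    using finite_cliques[OF assms(1)] by (intro Max_in) blast+
  then obtain C where "is_clique G C" "card C \<ge> 2"
    using assms(2) unfolding clique_number_def by auto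
  \<comment> \<open>An infinite set has \<open>card\<close> 0, so \<open>card C \<ge> 2\<close> also
    yields the finiteness that \<open>card_le_Suc0_iff_eq\<close> asks for.\<close>
  moreover from this obtain u v where "u \<in> C" "v \<in> C" "u \<noteq> v"
    using card_le_Suc0_iff_eq[of C] card.infinite[of C] by fastforce
  ultimately show ?thesis
    unfolding is_clique_def by blast
qed

lemma strongly_regular_product_complete:
  assumes G: "pair_graph G" and H: "pair_graph H"
    and sr: "strongly_regular (G \<box> H) n d l m" and "m > 0"
    and uv: "u \<in> pverts G" "v \<in> pverts G" "u \<noteq> v"
    and xy: "x \<in> pverts H" "y \<in> pverts H" "x \<noteq> y"
  shows "(u, v) \<in> parcs G" and "(x, y) \<in> parcs H"
proof -
  interpret G: pair_graph G by fact
  interpret H: pair_graph H by fact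
  have "((u, x), (v, y)) \<notin> parcs (G \<box> H)"
    using uv xy by (simp add: parcs_cartesian_product_iff)
  then have "card (common_neighbors (G \<box> H) (u, x) (v, y)) = m"
    using sr uv xy by (simp add: strongly_regular_def pverts_cartesian_product)
  then obtain w z where "(w, z) \<in> common_neighbors (G \<box> H) (u, x) (v, y)"
    using \<open>m > 0\<close> by (metis card.empty equals0I less_irrefl surj_pair)
  then have "((u, x), (w, z)) \<in> parcs (G \<box> H)" "((v, y), (w, z)) \<in> parcs (G \<box> H)"
    by (auto simp: common_neighbors_def)
  \<comment> \<open>Since \<open>u \<noteq> v\<close> and \<open>x \<noteq> y\<close>,
    \<open>(w, z)\<close> is \<open>(u, y)\<close> or \<open>(v, x)\<close>. Either way its two arcs
    move along different factors, so this one vertex yields adjacency in both factors, up to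
    symmetry.\<close>
  then show "(u, v) \<in> parcs G" "(x, y) \<in> parcs H"
    using uv xy
    by (auto simp: parcs_cartesian_product_iff intro: G.arcs_symmetric H.arcs_symmetric)
qed

lemma strongly_regular_product_card:
  assumes G: "pair_graph G" and H: "pair_graph H"
    and sr: "strongly_regular (G \<box> H) n d l m" and "m > 0"
    and uv: "u \<in> pverts G" "v \<in> pverts G" "u \<noteq> v"
    and xy: "x \<in> pverts H" "y \<in> pverts H" "x \<noteq> y"
  shows "card (pverts G) = l + 2" and "card (pverts H) = l + 2"
proof -
  interpret G: pair_graph G by fact
  interpret H: pair_graph H by fact
  \<comment> \<open>The fixed pair \<open>x\<close>, \<open>y\<close> serves as second coordinates
    for every pair \<open>a\<close>, \<open>b\<close>, so \<open>G\<close> is complete;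
    \<open>arcH\<close> uses \<open>u\<close>, \<open>v\<close> likewise.\<close>
  have arcG: "(a, b) \<in> parcs G \<longleftrightarrow> a \<noteq> b" if "a \<in> pverts G" "b \<in> pverts G" for a b
    using strongly_regular_product_complete(1)[OF G H sr \<open>m > 0\<close> that _ xy] G.pair_no_loops
    by fastforce
  have arcH: "(a, b) \<in> parcs H \<longleftrightarrow> a \<noteq> b" if "a \<in> pverts H" "b \<in> pverts H" for a b
    using strongly_regular_product_complete(2)[OF G H sr \<open>m > 0\<close> uv that] H.pair_no_loops
    by fastforce
  have "((u, x), (v, x)) \<in> parcs (G \<box> H)" "((u, x), (u, y)) \<in> parcs (G \<box> H)"
    using uv xy by (auto simp: parcs_cartesian_product_iff arcG arcH)
  then have l: "card (common_neighbors (G \<box> H) (u, x) (v, x)) = l"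
      "card (common_neighbors (G \<box> H) (u, x) (u, y)) = l"
    using sr uv xy by (auto simp: strongly_regular_def pverts_cartesian_product)
  \<comment> \<open>A common neighbour with second coordinate other than \<open>x\<close> would need
    first coordinate equal to both \<open>u\<close> and \<open>v\<close>. Within the fibre,
    completeness leaves every vertex except these two.\<close>
  have "common_neighbors (G \<box> H) (u, x) (v, x) = (pverts G - {u, v}) \<times> {x}"
    using uv xy
    by (auto simp: common_neighbors_def pverts_cartesian_product parcs_cartesian_product_iff
        arcG arcH)
  then have "card (pverts G - {u, v}) = l"
    using l(1) by (simp add: card_cartesian_product)
  \<comment> \<open>Excludes truncated subtraction in \<open>card (pverts G) - 2 = l\<close>, which
    matters when \<open>l = 0\<close>.\<close>
  moreover have "card (pverts G) \<ge> card {u, v}"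
    using uv by (intro card_mono) auto
  ultimately show "card (pverts G) = l + 2"
    using uv by (simp add: card_Diff_subset)
  have "common_neighbors (G \<box> H) (u, x) (u, y) = {u} \<times> (pverts H - {x, y})"
    using uv xy
    by (auto simp: common_neighbors_def pverts_cartesian_product parcs_cartesian_product_iff
        arcG arcH)
  then have "card (pverts H - {x, y}) = l"
    using l(2) by (simp add: card_cartesian_product)
  moreover have "card (pverts H) \<ge> card {x, y}"
    using xy by (intro card_mono) auto
  ultimately show "card (pverts H) = l + 2"
    using xy by (simp add: card_Diff_subset)
qed

theorem theorem11:
  shows "\<not> (\<exists>(G\<^sub>1 :: 'a pair_pre_digraph) (G\<^sub>2 :: 'b pair_pre_digraph) n\<^sub>1 d\<^sub>1 k\<^sub>1 n\<^sub>2 d\<^sub>2 k\<^sub>2.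
            regular_clique_assembly G\<^sub>1 n\<^sub>1 d\<^sub>1 k\<^sub>1 \<and>
            regular_clique_assembly G\<^sub>2 n\<^sub>2 d\<^sub>2 k\<^sub>2 \<and>
            strongly_regular (G\<^sub>1 \<box> G\<^sub>2) 99 14 1 2)"
proof safe
  fix G :: "'a pair_pre_digraph" and H :: "'b pair_pre_digraph" and n1 d1 k1 n2 d2 k2
  assume "regular_clique_assembly G n1 d1 k1" "regular_clique_assembly H n2 d2 k2"
    and sr: "strongly_regular (G \<box> H) 99 14 1 2"
  then have G: "pair_graph G" "clique_number G \<ge> 2" and H: "pair_graph H" "clique_number H \<ge> 2"
    by (auto simp: regular_clique_assembly_def)
  obtain u v where uv: "u \<in> pverts G" "v \<in> pverts G" "u \<noteq> v"
    using two_vertices_if_clique_number[OF G] by blast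
  obtain x y where xy: "x \<in> pverts H" "y \<in> pverts H" "x \<noteq> y"
    using two_vertices_if_clique_number[OF H] by blast
  \<comment> \<open>Here \<open>l = 1\<close>, and the open premise is \<open>2 > 0\<close>.\<close>
  have "card (pverts G) = 3" "card (pverts H) = 3"
    using strongly_regular_product_card[OF G(1) H(1) sr _ uv xy] by simp_all
  moreover have "card (pverts G \<times> pverts H) = 99"
    using sr by (simp add: strongly_regular_def pverts_cartesian_product)
  ultimately show False
    by (simp add: card_cartesian_product)
qed

end
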